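(* Let $G$ be a bipartite graph of order $n$, $e$ a cut edge of $G$, and $G(k)$ the $k$-subdivision graph (of order $n+k$) of $G$ on $e$. Then $\widetilde{\phi}(G(k+2),x)=x\,\widetilde{\phi}(G(k+1),x)+\widetilde{\phi}(G(k),x)$ for all $k\ge 0$.
   Context: For a graph $G$ of order $n$, $\phi(G,x)=\det(xI-A(G))=\sum_{i=0}^n a_i(G)x^{n-i}$, and $\widetilde{\phi}(G,x)=\sum_{i=0}^n |a_i(G)|x^{n-i}$. For a cut edge $e$ of $G$, $G(k)$ is obtained by replacing $e$ with a path of length $k+1$; $G(0)=G$. *)

theory Defs
  imports
    "Graph_Theory.Digraph_Component"
    "Graph_Theory.Pair_Digraph"
    "Jordan_Normal_Form.Char_Poly"
begin

text \<open>
  A finite simple graph is a \<^locale>\<open>pair_graph\<close>: a finite, loop-free, symmetric relation on its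
  vertex set. An undirected edge is thus a pair of opposite arcs, and is named by either of them;
  its connected components are the strongly connected components of the library.
\<close>

definition bipartite :: "'a pair_pre_digraph \<Rightarrow> bool" where
  "bipartite G \<longleftrightarrow> (\<exists>X Y. pverts G = X \<union> Y \<and> X \<inter> Y = {} \<and> parcs G \<subseteq> X \<times> Y \<union> Y \<times> X)"

definition delete_edge :: "'a pair_pre_digraph \<Rightarrow> 'a \<times> 'a \<Rightarrow> 'a pair_pre_digraph" where
  "delete_edge G e = \<lparr>pverts = pverts G, parcs = parcs G - {e, prod.swap e}\<rparr>"

definition num_components :: "'a pair_pre_digraph \<Rightarrow> nat" where
  "num_components G = card (pre_digraph.sccs (with_proj G))"

definition cut_edge :: "'a pair_pre_digraph \<Rightarrow> 'a \<times> 'a \<Rightarrow> bool" where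
  "cut_edge G e \<longleftrightarrow> e \<in> parcs G \<and> num_components G < num_components (delete_edge G e)"


text \<open>
  \<open>k_subdivision G (u, v) k\<close> replaces the edge \<open>{u, v}\<close> by the path
  \<open>u, w\<^sub>0, \<dots>, w\<^bsub>k-1\<^esub>, v\<close> of length \<open>k + 1\<close>. The sum type supplies the fresh vertices
  \<open>w\<^sub>i = Inr i\<close>; the vertices of \<open>G\<close> reappear as \<open>Inl x\<close>, so \<open>G(0)\<close> is the copy of \<open>G\<close>
  under \<open>Inl\<close>.
\<close>

definition path_arcs :: "'b list \<Rightarrow> 'b rel" where
  "path_arcs p = set (zip p (tl p)) \<union> (set (zip p (tl p)))\<inverse>"

definition k_subdivision :: "'a pair_pre_digraph \<Rightarrow> 'a \<times> 'a \<Rightarrow> nat \<Rightarrow> ('a + nat) pair_pre_digraph" where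
  "k_subdivision G e k =
    \<lparr>pverts = Inl ` pverts G \<union> Inr ` {..<k},
     parcs = map_prod Inl Inl ` parcs (delete_edge G e)
       \<union> path_arcs (Inl (fst e) # map Inr [0..<k] @ [Inl (snd e)])\<rparr>"

lemma k_subdivision_0:
  assumes "pair_graph G" "e \<in> parcs G"
  shows "k_subdivision G e 0 = \<lparr>pverts = Inl ` pverts G, parcs = map_prod Inl Inl ` parcs G\<rparr>"
proof -
  interpret pair_graph G by fact
  have "prod.swap e \<in> parcs G"
    using arcs_symmetric assms(2) by (cases e) auto
  then show ?thesis
    using assms(2) by (cases e) (auto simp: k_subdivision_def delete_edge_def path_arcs_def)
qed

lemma order_k_subdivision:
  assumes "pair_graph G"
  shows "card (pverts (k_subdivision G e k)) = card (pverts G) + k"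
proof -
  interpret pair_graph G by fact
  have "card (Inl ` pverts G \<union> Inr ` {..<k} :: ('a + nat) set)
      = card (Inl ` pverts G :: ('a + nat) set) + card (Inr ` {..<k} :: ('a + nat) set)"
    using pair_finite_verts by (intro card_Un_disjoint) auto
  then show ?thesis
    by (simp add: k_subdivision_def card_image)
qed


text \<open>
  \<open>graph_char_poly\<close> uses an arbitrary enumeration of the vertices;
  by \<open>graph_char_poly_eq\<close> below the choice does not matter.
\<close>

definition adjacency_mat :: "'a pair_pre_digraph \<Rightarrow> 'a list \<Rightarrow> real mat" where
  "adjacency_mat G vs = mat (length vs) (length vs)
     (\<lambda>(i, j). if (vs ! i, vs ! j) \<in> parcs G then 1 else 0)"

definition graph_char_poly :: "'a pair_pre_digraph \<Rightarrow> real poly" where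
  "graph_char_poly G = char_poly (adjacency_mat G (SOME vs. distinct vs \<and> set vs = pverts G))"

definition char_coeff :: "'a pair_pre_digraph \<Rightarrow> nat \<Rightarrow> real" where
  "char_coeff G i = coeff (graph_char_poly G) (card (pverts G) - i)"

definition abs_char_poly :: "'a pair_pre_digraph \<Rightarrow> real poly" where
  "abs_char_poly G = (\<Sum>i\<le>card (pverts G). monom \<bar>char_coeff G i\<bar> (card (pverts G) - i))"

lemma char_poly_reindex:
  fixes A :: "real mat"
  assumes A: "A \<in> carrier_mat n n" and p: "p permutes {0..<n}"
  shows "char_poly (mat n n (\<lambda>(i, j). A $$ (p i, p j))) = char_poly A"
proof -
  let ?C = "char_poly_matrix A"
  let ?R = "mat n n (\<lambda>(i, j). ?C $$ (p i, j))"
  let ?D = "mat n n (\<lambda>(i, j). transpose_mat ?R $$ (p i, j))"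
  have C: "?C \<in> carrier_mat n n" using A by simp
  have lt: "p i < n" if "i < n" for i
    using permutes_in_image[OF p, of i] that by simp
  have inj: "p i = p j \<longleftrightarrow> i = j" for i j
    using permutes_inj[OF p] by (auto dest: injD)
  have eq: "char_poly_matrix (mat n n (\<lambda>(i, j). A $$ (p i, p j))) = transpose_mat ?D"
    using A by (intro eq_matI) (auto simp: char_poly_matrix_def lt inj)
  have "det (transpose_mat ?D) = det ?D"
    by (rule det_transpose[of _ n]) simp
  also have "\<dots> = signof p * det (transpose_mat ?R)"
    by (rule det_permute_rows[OF _ p]) simp
  also have "det (transpose_mat ?R) = det ?R"
    by (rule det_transpose[of _ n]) simp
  also have "det ?R = signof p * det ?C"
    by (rule det_permute_rows[OF C p])
  also have "signof p * (signof p * det ?C) = det ?C"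
    by (simp add: sign_def)
  finally show ?thesis
    by (simp add: char_poly_def eq)
qed

lemma char_poly_adjacency_mat:
  assumes "distinct vs" "distinct ws" "set vs = set ws"
  shows "char_poly (adjacency_mat G vs) = char_poly (adjacency_mat G ws)"
proof -
  have "mset vs = mset ws" using assms by (simp add: set_eq_iff_mset_eq_distinct)
  then obtain p where p: "p permutes {..<length ws}" and vs: "permute_list p ws = vs"
    by (rule mset_eq_permutation)
  have lt: "p i < length ws" if "i < length ws" for i
    using permutes_in_image[OF p, of i] that by simp
  have len: "length vs = length ws" using vs by auto
  have "adjacency_mat G vs
      = mat (length ws) (length ws) (\<lambda>(i, j). adjacency_mat G ws $$ (p i, p j))"
    using len by (intro eq_matI) (auto simp: adjacency_mat_def lt permute_list_nth[OF p] simp flip: vs)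
  moreover have "adjacency_mat G ws \<in> carrier_mat (length ws) (length ws)"
    by (simp add: adjacency_mat_def)
  ultimately show ?thesis
    using char_poly_reindex p by (simp add: atLeast0LessThan)
qed

lemma graph_char_poly_eq:
  assumes "distinct vs" "set vs = pverts G"
  shows "graph_char_poly G = char_poly (adjacency_mat G vs)"
proof -
  have "distinct (SOME vs. distinct vs \<and> set vs = pverts G)
      \<and> set (SOME vs. distinct vs \<and> set vs = pverts G) = pverts G"
    using assms by (intro someI[of "\<lambda>vs. distinct vs \<and> set vs = pverts G"]) simp
  then show ?thesis
    unfolding graph_char_poly_def using assms by (intro char_poly_adjacency_mat) auto
qed

lemma abs_char_poly_k_subdivision_0:
  assumes "pair_graph G" "e \<in> parcs G"
  shows "abs_char_poly (k_subdivision G e 0) = abs_char_poly G"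
proof -
  interpret pair_graph G by fact
  obtain vs where vs: "distinct vs" "set vs = pverts G"
    using finite_distinct_list[OF pair_finite_verts] by blast
  let ?H = "k_subdivision G e 0"
  have H: "pverts ?H = Inl ` pverts G" "parcs ?H = map_prod Inl Inl ` parcs G"
    using k_subdivision_0[OF assms] by simp_all
  have "graph_char_poly ?H = char_poly (adjacency_mat ?H (map Inl vs))"
    using vs by (intro graph_char_poly_eq) (auto simp: H distinct_map)
  also have "adjacency_mat ?H (map Inl vs) = adjacency_mat G vs"
    by (intro eq_matI) (auto simp: adjacency_mat_def H map_prod_def)
  also have "char_poly \<dots> = graph_char_poly G"
    using vs by (simp add: graph_char_poly_eq)
  finally show ?thesis
    by (simp add: abs_char_poly_def char_coeff_def order_k_subdivision[OF assms(1)])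
qed

lemma pair_graph_k_subdivision:
  assumes "pair_graph G" "e \<in> parcs G"
  shows "pair_graph (k_subdivision G e k)"
proof -
  interpret pair_graph G by fact
  let ?p = "Inl (fst e) # map Inr [0..<k] @ [Inl (snd e)] :: ('a + nat) list"
  let ?H = "k_subdivision G e k"
  have "fst e \<noteq> snd e" using pair_no_loops assms(2) by blast
  then have d: "distinct ?p" by (auto simp: distinct_map)
  have path: "a \<in> set ?p \<and> b \<in> set ?p \<and> a \<noteq> b" if "(a, b) \<in> path_arcs ?p" for a b
  proof -
    have *: "x \<in> set ?p \<and> y \<in> set ?p \<and> x \<noteq> y" if xy: "(x, y) \<in> set (zip ?p (tl ?p))" for x y
    proof -
      obtain i where i: "i < length (tl ?p)" "x = ?p ! i" "y = tl ?p ! i"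
        using xy by (auto simp only: in_set_zip fst_conv snd_conv)
      then have l: "Suc i < length ?p" and y: "y = ?p ! Suc i" by auto
      have "i < length ?p" using l by linarith
      then show ?thesis
        using l y i(2) nth_mem[of i ?p] nth_mem[of "Suc i" ?p] nth_eq_iff_index_eq[OF d, of i "Suc i"]
        by (metis n_not_Suc_n)
    qed
    show ?thesis using that * unfolding path_arcs_def by blast
  qed
  have sub: "set ?p \<subseteq> pverts ?H"
    using arc_fst_in_verts arc_snd_in_verts assms(2) by (auto simp: k_subdivision_def)
  have arcs: "a \<in> pverts ?H \<and> b \<in> pverts ?H \<and> a \<noteq> b" if "(a, b) \<in> parcs ?H" for a b
  proof -
    have "(a, b) \<in> map_prod Inl Inl ` parcs (delete_edge G e) \<or> (a, b) \<in> path_arcs ?p"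
      using that by (simp add: k_subdivision_def)
    then show ?thesis
    proof
      assume "(a, b) \<in> map_prod Inl Inl ` parcs (delete_edge G e)"
      then show ?thesis
        by (auto simp: delete_edge_def k_subdivision_def dest: in_arcsD1 in_arcsD2 no_loops')
    next
      assume "(a, b) \<in> path_arcs ?p"
      then show ?thesis using path sub by blast
    qed
  qed
  have "sym (parcs ?H)"
    using arcs_symmetric
    by (auto simp: sym_def k_subdivision_def delete_edge_def path_arcs_def prod.swap_def)
  moreover have "finite (parcs ?H)"
    using pair_finite_arcs by (auto simp: k_subdivision_def delete_edge_def path_arcs_def)
  moreover have "finite (pverts ?H)"
    using pair_finite_verts by (simp add: k_subdivision_def)
  ultimately show ?thesis
    using arcs by unfold_locales (auto simp: symmetric_def)
qed

end

theory Submission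
  imports Defs
begin

text \<open>
  Expanding the determinant along a cut edge \<open>{a, b}\<close> that separates \<open>H\<^sub>a\<close> from \<open>H\<^sub>b\<close> gives
  \<open>\<phi>(H) = \<phi>(H\<^sub>a) \<phi>(H\<^sub>b) - \<phi>(H\<^sub>a - a) \<phi>(H\<^sub>b - b)\<close>. Applied to the first edge of the inserted path,
  and to the pendant paths that this leaves, it yields \<open>\<phi>(G(k+2)) = x \<phi>(G(k+1)) - \<phi>(G(k))\<close>.
  For a bipartite graph \<open>H\<close> of order \<open>n\<close>, conjugating the adjacency matrix by a diagonal matrix with
  entries \<open>1\<close> and \<open>\<i>\<close> on the two classes turns it into \<open>\<i> S\<close> with \<open>S\<close> real and skew-symmetric, so
  \<open>\<phi>(H, \<i>x) = \<i>\<^sup>n det(x - S)\<close>. The coefficients of \<open>det(x - S)\<close> are nonnegative, hence equal to the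
  absolute values of those of \<open>\<phi>(H)\<close>. Every \<open>G(k)\<close> is bipartite because a 2-colouring can be flipped
  on one side of the cut edge, and substituting \<open>\<i>x\<close> turns the minus sign of the recurrence into a plus.
\<close>

section \<open>Determinants of two blocks joined by one edge\<close>

text \<open>Laplace expansion along row \<open>n\<close>, the last row of \<open>A\<close>: columns
  inside \<open>A\<close> contribute \<open>det A * det B\<close>, and the only other nonzero entry
  of that row is \<open>c\<close>, in column \<open>Suc n\<close>.\<close>

lemma det_glue:
  fixes A B :: "'a :: idom mat"
  assumes A: "A \<in> carrier_mat (Suc n) (Suc n)" and B: "B \<in> carrier_mat (Suc m) (Suc m)"
    and C: "C = mat (Suc n) (Suc m) (\<lambda>(i, j). if i = n \<and> j = 0 then c else 0)"
    and D: "D = mat (Suc m) (Suc n) (\<lambda>(i, j). if i = 0 \<and> j = n then d else 0)"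
  shows "det (four_block_mat A C D B)
    = det A * det B - c * d * det (mat_delete A n n) * det (mat_delete B 0 0)"
proof -
  let ?M = "four_block_mat A C D B"
  have M: "?M \<in> carrier_mat (Suc n + Suc m) (Suc n + Suc m)"
    using A B by auto
  have left: "?M $$ (n, j) * cofactor ?M n j = A $$ (n, j) * cofactor A n j * det B"
    if "j < Suc n" for j
  proof -
    have eq: "mat_delete ?M n j
        = four_block_mat (mat_delete A n j) (0\<^sub>m n (Suc m)) (mat (Suc m) n (\<lambda>(i, k). D $$ (i, if k < j then k else Suc k))) B"
      using A B that
      by (intro eq_matI) (auto simp: mat_delete_def C D not_less_eq le_Suc_eq)
    have "det (mat_delete ?M n j) = det (mat_delete A n j) * det B"
      unfolding eq using A B that mat_delete_carrier[OF A]
      by (intro det_four_block_mat_upper_right_zero) (auto simp: D mat_delete_def)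
    then show ?thesis
      using A B that by (simp add: cofactor_def)
  qed
  have right: "?M $$ (n, j) * cofactor ?M n j
      = (if j = Suc n then - c * d * det (mat_delete A n n) * det (mat_delete B 0 0) else 0)"
    if j: "Suc n \<le> j" "j < Suc n + Suc m" for j
  proof (cases "j = Suc n")
    case True
    \<comment> \<open>The minor at \<open>c\<close> is block triangular once the first row of
      \<open>B\<close> is grouped with the rows of \<open>A\<close>. \<open>P\<close> is its leading
      block; the last row of \<open>P\<close> is the first row of \<open>D\<close>.\<close>
    define P where "P = four_block_mat (mat_delete A n n) (mat n 1 (\<lambda>(i, j). A $$ (i, n)))
      (0\<^sub>m 1 n) (mat 1 1 (\<lambda>_. d))"
    have idx: "Suc (i - Suc n) = i - n" if "n < i" for i
      using that by simp
    have mid: "i = n" if "n < Suc i" "i < Suc n" for i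
      using that by simp
    have eq: "mat_delete ?M n (Suc n) = four_block_mat P
        (mat (Suc n) m (\<lambda>(i, j). if i = n then B $$ (0, Suc j) else 0))
        (0\<^sub>m m (Suc n)) (mat_delete B 0 0)"
      using A B unfolding P_def
      by (intro eq_matI) (auto simp: mat_delete_def C D not_less_eq le_Suc_eq Suc_diff_le idx dest: mid)
    have P: "P \<in> carrier_mat (Suc n) (Suc n)"
      using A unfolding P_def by (auto simp: mat_delete_def)
    have "det P = det (mat_delete A n n) * d"
      unfolding P_def using mat_delete_carrier[OF A]
      by (subst det_four_block_mat_lower_left_zero[where n = n and m = 1]) (auto simp: det_single)
    moreover have "det (mat_delete ?M n (Suc n)) = det P * det (mat_delete B 0 0)"
      unfolding eq using P mat_delete_carrier[OF B]
      by (intro det_four_block_mat_lower_left_zero) auto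
    ultimately show ?thesis
      using A B True by (simp add: cofactor_def C)
  next
    case False
    then show ?thesis using A B j by (simp add: C)
  qed
  have "det ?M = (\<Sum>j<Suc n + Suc m. ?M $$ (n, j) * cofactor ?M n j)"
    using M by (intro laplace_expansion_row) auto
  also have "{..<Suc n + Suc m} = {..<Suc n} \<union> {Suc n..<Suc n + Suc m}"
    by auto
  also have "(\<Sum>j\<in>\<dots>. ?M $$ (n, j) * cofactor ?M n j)
      = (\<Sum>j<Suc n. ?M $$ (n, j) * cofactor ?M n j)
        + (\<Sum>j\<in>{Suc n..<Suc n + Suc m}. ?M $$ (n, j) * cofactor ?M n j)"
    by (rule sum.union_disjoint) auto
  also have "(\<Sum>j<Suc n. ?M $$ (n, j) * cofactor ?M n j)
      = (\<Sum>j<Suc n. A $$ (n, j) * cofactor A n j * det B)"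
    by (rule sum.cong[OF refl]) (rule left, simp)
  also have "(\<Sum>j\<in>{Suc n..<Suc n + Suc m}. ?M $$ (n, j) * cofactor ?M n j)
      = (\<Sum>j\<in>{Suc n..<Suc n + Suc m}. if j = Suc n
          then - c * d * det (mat_delete A n n) * det (mat_delete B 0 0) else 0)"
    by (rule sum.cong[OF refl]) (rule right, simp_all)
  also have "(\<Sum>j<Suc n. A $$ (n, j) * cofactor A n j * det B) = det A * det B"
    using laplace_expansion_row[OF A, of n] by (simp add: sum_distrib_right del: sum.lessThan_Suc)
  finally show ?thesis
    by (simp del: sum.op_ivl_Suc)
qed

text \<open>Listing \<open>a\<close> last and \<open>b\<close> first puts the connecting edge in the
  corner that \<open>det_glue\<close> expects. Both corner entries of \<open>xI - A\<close> are
  \<open>-1\<close>, so \<open>c * d = 1\<close>.\<close>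

lemma char_poly_adjacency_glue:
  assumes ab: "(a, b) \<in> parcs G" "(b, a) \<in> parcs G"
    and sep: "\<And>x y. x \<in> set (us @ [a]) \<Longrightarrow> y \<in> set (b # ws) \<Longrightarrow>
      (x, y) \<in> parcs G \<or> (y, x) \<in> parcs G \<Longrightarrow> x = a \<and> y = b"
    and dist: "distinct (us @ [a])" "distinct (b # ws)"
  shows "char_poly (adjacency_mat G (us @ a # b # ws))
    = char_poly (adjacency_mat G (us @ [a])) * char_poly (adjacency_mat G (b # ws))
      - char_poly (adjacency_mat G us) * char_poly (adjacency_mat G ws)"
proof -
  let ?n = "length us" and ?m = "length ws"
  let ?A = "char_poly_matrix (adjacency_mat G (us @ [a]))"
  let ?B = "char_poly_matrix (adjacency_mat G (b # ws))"
  let ?C = "mat (Suc ?n) (Suc ?m) (\<lambda>(i, j). if i = ?n \<and> j = 0 then -1 else 0) :: real poly mat"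
  let ?D = "mat (Suc ?m) (Suc ?n) (\<lambda>(i, j). if i = 0 \<and> j = ?n then -1 else 0) :: real poly mat"
  have A: "?A \<in> carrier_mat (Suc ?n) (Suc ?n)" and B: "?B \<in> carrier_mat (Suc ?m) (Suc ?m)"
    by (auto simp: adjacency_mat_def)
  have arc: "(us @ [a]) ! i = a \<longleftrightarrow> i = ?n" if "i < Suc ?n" for i
    using dist(1) that nth_eq_iff_index_eq[of "us @ [a]" i ?n] by auto
  have arc': "(b # ws) ! j = b \<longleftrightarrow> j = 0" if "j < Suc ?m" for j
    using dist(2) that nth_eq_iff_index_eq[of "b # ws" j 0] by auto
  have split: "(us @ a # b # ws) ! i = (if i < Suc ?n then (us @ [a]) ! i else (b # ws) ! (i - Suc ?n))" for i
    by (auto simp: nth_append less_Suc_eq)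
  have cross: "((us @ [a]) ! i, (b # ws) ! j) \<in> parcs G \<longleftrightarrow> i = ?n \<and> j = 0"
    "((b # ws) ! j, (us @ [a]) ! i) \<in> parcs G \<longleftrightarrow> i = ?n \<and> j = 0"
    if "i < Suc ?n" "j < Suc ?m" for i j
  proof -
    have mem: "(us @ [a]) ! i \<in> set (us @ [a])" "(b # ws) ! j \<in> set (b # ws)"
      using that by (intro nth_mem; simp)+
    show "((us @ [a]) ! i, (b # ws) ! j) \<in> parcs G \<longleftrightarrow> i = ?n \<and> j = 0"
      "((b # ws) ! j, (us @ [a]) ! i) \<in> parcs G \<longleftrightarrow> i = ?n \<and> j = 0"
      using sep[OF mem] arc[OF that(1)] arc'[OF that(2)] ab by metis+
  qed
  have M: "char_poly_matrix (adjacency_mat G (us @ a # b # ws)) = four_block_mat ?A ?C ?D ?B"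
    (is "?L = ?R")
  proof (rule eq_matI)
    fix i j assume "i < dim_row ?R" "j < dim_col ?R"
    then have ij: "i < Suc ?n + Suc ?m" "j < Suc ?n + Suc ?m"
      by (simp_all add: adjacency_mat_def char_poly_matrix_def)
    have entry: "?L $$ (i, j) = (if i = j then [:0, 1:] else 0)
        + [: - (if ((us @ a # b # ws) ! i, (us @ a # b # ws) ! j) \<in> parcs G then 1 else 0) :]"
      using ij by (simp add: adjacency_mat_def char_poly_matrix_def)
    consider "i < Suc ?n" "j < Suc ?n"
      | j' where "i < Suc ?n" "j = Suc ?n + j'" "j' < Suc ?m"
      | i' where "i = Suc ?n + i'" "i' < Suc ?m" "j < Suc ?n"
      | i' j' where "i = Suc ?n + i'" "i' < Suc ?m" "j = Suc ?n + j'" "j' < Suc ?m"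
      using ij by (metis add_less_cancel_left le_Suc_ex not_less)
    then show "?L $$ (i, j) = ?R $$ (i, j)"
    proof cases
      case 1
      then show ?thesis unfolding entry split
        by (simp add: adjacency_mat_def char_poly_matrix_def)
    next
      case 2
      then show ?thesis unfolding entry split
        using cross[of i j'] by (auto simp: adjacency_mat_def char_poly_matrix_def one_pCons)
    next
      case 3
      then show ?thesis unfolding entry split
        using cross[of j i'] by (auto simp: adjacency_mat_def char_poly_matrix_def one_pCons)
    next
      case 4
      then show ?thesis unfolding entry split
        by (simp add: adjacency_mat_def char_poly_matrix_def)
    qed
  qed (simp_all add: adjacency_mat_def char_poly_matrix_def)
  have "mat_delete ?A ?n ?n = char_poly_matrix (adjacency_mat G us)"
    by (intro eq_matI) (auto simp: mat_delete_def adjacency_mat_def char_poly_matrix_def nth_append)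
  moreover have "mat_delete ?B 0 0 = char_poly_matrix (adjacency_mat G ws)"
    by (intro eq_matI) (auto simp: mat_delete_def adjacency_mat_def char_poly_matrix_def)
  ultimately show ?thesis
    using det_glue[OF A B refl refl, of "-1" "-1"] by (simp add: char_poly_def M)
qed

section \<open>Skew-symmetric matrices and the imaginary substitution\<close>

text \<open>Moving \<open>S\<close> across the scalar product flips its sign, so
  \<open>y * (v \<bullet> v)\<close> equals its own negative.\<close>

lemma skew_symmetric_no_pos_eigenvalue:
  fixes S :: "real mat"
  assumes S: "S \<in> carrier_mat n n" and skew: "transpose_mat S = - S"
    and ev: "eigenvalue S y"
  shows "y = 0"
proof -
  obtain v where v: "v \<in> carrier_vec n" "v \<noteq> 0\<^sub>v n" "S *\<^sub>v v = y \<cdot>\<^sub>v v"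
    using ev S unfolding eigenvalue_def eigenvector_def by auto
  have "y * (v \<bullet> v) = v \<bullet> (S *\<^sub>v v)"
    using v by simp
  also have "\<dots> = (transpose_mat S *\<^sub>v v) \<bullet> v"
    using transpose_vec_mult_scalar[OF S v(1) v(1)] by simp
  also have "\<dots> = - (y * (v \<bullet> v))"
    using S v by (simp add: skew)
  finally have "y * (v \<bullet> v) = 0"
    by simp
  moreover have "v \<bullet> v \<noteq> 0"
  proof
    assume "v \<bullet> v = 0"
    then have "\<forall>i<n. v $ i = 0"
      using v(1) by (auto simp: scalar_prod_def sum_nonneg_eq_0_iff)
    then show False using v(1,2) by auto
  qed
  ultimately show ?thesis by simp
qed

text \<open>
  The derivative of the characteristic polynomial is the sum of those of the principal submatrices,
  so by induction only the constant coefficient is at stake; there, a negative value would force a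
  positive real eigenvalue.
\<close>

lemma coeff_char_poly_skew_symmetric_nonneg:
  fixes S :: "real mat"
  assumes "S \<in> carrier_mat n n" "transpose_mat S = - S"
  shows "coeff (char_poly S) j \<ge> 0"
  using assms
proof (induction n arbitrary: S j)
  case 0
  then have "char_poly S = 1"
    by (simp add: char_poly_def)
  then show ?case by simp
next
  case (Suc n)
  note S = Suc.prems(1)
  have entry: "S $$ (b, a) = - S $$ (a, b)" if "a < Suc n" "b < Suc n" for a b
    using arg_cong[OF Suc.prems(2), of "\<lambda>M. M $$ (a, b)"] S that by simp
  have lead: "lead_coeff (char_poly S) = 1"
    using degree_monic_char_poly[OF S] by simp
  show ?case
  proof (cases j)
    case 0
    have "poly (char_poly S) 0 \<ge> 0"
    proof (rule ccontr)
      assume neg: "\<not> poly (char_poly S) 0 \<ge> 0"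
      obtain b where b: "\<And>x. x \<ge> b \<Longrightarrow> poly (char_poly S) x \<ge> 1"
        using poly_pinfty_gt_lc[of "char_poly S"] lead by auto
      \<comment> \<open>The bound \<open>b\<close> may be negative; \<open>max b 1\<close> puts the
        right endpoint beyond 0.\<close>
      have "poly (char_poly S) (max b 1) > 0"
        using b[of "max b 1"] by simp
      then obtain y where y: "y > 0" "poly (char_poly S) y = 0"
        using poly_IVT_pos[of 0 "max b 1" "char_poly S"] neg by (auto simp: less_max_iff_disj)
      then show False
        using skew_symmetric_no_pos_eigenvalue[OF S Suc.prems(2)] eigenvalue_root_char_poly[OF S]
        by auto
    qed
    then show ?thesis using 0 by (simp add: poly_0_coeff_0)
  next
    case (Suc i)
    have "real (Suc i) * coeff (char_poly S) (Suc i) = coeff (pderiv (char_poly S)) i"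
      by (simp add: coeff_pderiv)
    also have "\<dots> = (\<Sum>a<Suc n. coeff (char_poly (mat_delete S a a)) i)"
      unfolding pderiv_char_poly[OF S] by (simp only: coeff_sum)
    also have "\<dots> \<ge> 0"
    proof (rule sum_nonneg)
      fix a assume "a \<in> {..<Suc n}"
      moreover have "transpose_mat (mat_delete S a a) = - mat_delete S a a"
        using S by (intro eq_matI) (auto simp: mat_delete_def intro!: entry)
      ultimately show "coeff (char_poly (mat_delete S a a)) i \<ge> 0"
        using S mat_delete_carrier[OF S] by (intro Suc.IH) auto
    qed
    finally show ?thesis
      using Suc by (simp add: zero_le_mult_iff)
  qed
qed

text \<open>With \<open>D = diag(d)\<close>, \<open>twist\<close> reads
  \<open>A D = \<i> D S\<close>, so \<open>A\<close> is similar to \<open>\<i> S\<close>. Hence the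
  characteristic polynomial of \<open>A\<close> at \<open>\<i> x\<close> is \<open>\<i> ^ n\<close>
  times that of \<open>S\<close> at \<open>x\<close>, and coefficients can be compared.\<close>

lemma coeff_char_poly_twist:
  fixes A S :: "real mat" and d :: "nat \<Rightarrow> complex"
  assumes A: "A \<in> carrier_mat n n" and S: "S \<in> carrier_mat n n"
    and d: "\<And>a. a < n \<Longrightarrow> d a \<noteq> 0"
    and twist: "\<And>a b. a < n \<Longrightarrow> b < n \<Longrightarrow>
      of_real (A $$ (a, b)) * d b = \<i> * d a * of_real (S $$ (a, b))"
  shows "\<i> ^ j * of_real (coeff (char_poly A) j) = \<i> ^ n * of_real (coeff (char_poly S) j)"
proof -
  define A' S' where "A' = map_mat complex_of_real A" and "S' = map_mat complex_of_real S"
  have A': "A' \<in> carrier_mat n n" and S': "S' \<in> carrier_mat n n"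
    using A S by (auto simp: A'_def S'_def)
  let ?D = "mat_diag n d"
  have nz: "det ?D \<noteq> 0"
    using d by (subst det_upper_triangular[of _ n]) (auto simp: mat_diag_def diag_mat_def prod_list_zero_iff)
  have "poly (char_poly A') (\<i> * x) = \<i> ^ n * poly (char_poly S') x" for x
  proof -
    let ?MA = "- char_matrix A' (\<i> * x)" and ?MS = "- char_matrix S' x"
    have MA: "?MA \<in> carrier_mat n n" and MS: "?MS \<in> carrier_mat n n"
      using A' S' by simp_all
    have tw: "d b * (of_real (A $$ (a, b))) = d a * (\<i> * of_real (S $$ (a, b)))" if "a < n" "b < n" for a b
      using twist[OF that] by (simp add: mult_ac)
    have "?MA * ?D = \<i> \<cdot>\<^sub>m (?D * ?MS)"
      unfolding mat_diag_mult_right[OF MA] mat_diag_mult_left[OF MS]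
      using A S A' S'
      by (intro eq_matI) (auto simp: char_matrix_def A'_def S'_def algebra_simps tw)
    then have "det ?MA * det ?D = \<i> ^ n * (det ?D * det ?MS)"
      using det_mult[OF MA, of ?D] det_mult[OF mat_diag_dim MS, of d] MS by (auto simp: mult.commute)
    then show ?thesis
      using nz unfolding char_poly_matrix[OF A'] char_poly_matrix[OF S']
      by (metis mult.commute mult.left_commute mult_cancel_right)
  qed
  \<comment> \<open>Agreement at every complex point gives equality of polynomials; composing with
    \<open>[:0, \<i>:]\<close> multiplies coefficient \<open>j\<close> by
    \<open>\<i> ^ j\<close>.\<close>
  then have "pcompose (char_poly A') [:0, \<i>:] = Polynomial.smult (\<i> ^ n) (char_poly S')"
    by (subst poly_eq_poly_eq_iff[symmetric]) (auto simp: poly_pcompose mult.commute)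
  then have "coeff (pcompose (char_poly A') [:0, \<i>:]) j = coeff (Polynomial.smult (\<i> ^ n) (char_poly S')) j"
    by simp
  then show ?thesis
    unfolding coeff_pcompose_linear coeff_smult A'_def S'_def
      of_real_hom.char_poly_hom[OF A] of_real_hom.char_poly_hom[OF S] of_real_hom.coeff_map_poly_hom .
qed

section \<open>Bipartite graphs and absolute coefficients\<close>

text \<open>A Boolean colouring is the form needed later: it selects the diagonal entries
  \<open>1\<close> and \<open>\<i>\<close>, and it can be flipped on part of the vertices.\<close>

lemma bipartite_iff_coloring:
  fixes G :: "'a pair_pre_digraph"
  assumes "pair_wf_digraph G"
  shows "bipartite G \<longleftrightarrow> (\<exists>c :: 'a \<Rightarrow> bool. \<forall>(x, y) \<in> parcs G. c x \<noteq> c y)"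
proof
  interpret pair_wf_digraph G by fact
  show "\<exists>c :: 'a \<Rightarrow> bool. \<forall>(x, y) \<in> parcs G. c x \<noteq> c y" if G: "bipartite G"
  proof -
    obtain X Y where "X \<inter> Y = {}" "parcs G \<subseteq> X \<times> Y \<union> Y \<times> X"
      using G by (auto simp: bipartite_def)
    then show ?thesis
      by (intro exI[of _ "\<lambda>x. x \<in> X"]) blast
  qed
  show "bipartite G" if col: "\<exists>c :: 'a \<Rightarrow> bool. \<forall>(x, y) \<in> parcs G. c x \<noteq> c y"
  proof -
    obtain c :: "'a \<Rightarrow> bool" where c: "\<forall>(x, y) \<in> parcs G. c x \<noteq> c y"
      using col by blast
    show ?thesis unfolding bipartite_def
      using c by (intro exI[of _ "{x \<in> pverts G. c x}"] exI[of _ "{x \<in> pverts G. \<not> c x}"])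
        (auto dest: in_arcsD1 in_arcsD2)
  qed
qed

text \<open>The sum in \<open>abs_char_poly\<close> lists the coefficients from the top; beyond the
  order of \<open>G\<close> both sides vanish, as the polynomial has that degree.\<close>

lemma coeff_abs_char_poly:
  assumes "finite (pverts G)"
  shows "coeff (abs_char_poly G) j = \<bar>coeff (graph_char_poly G) j\<bar>"
proof -
  let ?n = "card (pverts G)"
  obtain vs where vs: "distinct vs" "set vs = pverts G"
    using finite_distinct_list[OF assms] by blast
  have "adjacency_mat G vs \<in> carrier_mat ?n ?n"
    using vs distinct_card[of vs] by (simp add: adjacency_mat_def)
  then have deg: "degree (graph_char_poly G) = ?n"
    using degree_monic_char_poly graph_char_poly_eq[OF vs] by metis
  have "coeff (abs_char_poly G) j
      = (\<Sum>i\<le>?n. if ?n - i = j then \<bar>coeff (graph_char_poly G) (?n - i)\<bar> else 0)"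
    by (simp add: abs_char_poly_def char_coeff_def coeff_sum)
  also have "\<dots> = (\<Sum>i\<le>?n. if i = j then \<bar>coeff (graph_char_poly G) i\<bar> else 0)"
    by (rule sum.reindex_bij_witness[of _ "\<lambda>i. ?n - i" "\<lambda>i. ?n - i"]) auto
  also have "\<dots> = \<bar>coeff (graph_char_poly G) j\<bar>"
    using deg by (auto simp: coeff_eq_0)
  finally show ?thesis .
qed

lemma coeff_graph_char_poly_bipartite:
  fixes G :: "'a pair_pre_digraph"
  assumes G: "pair_graph G" and "bipartite G"
  shows "\<i> ^ j * of_real (coeff (graph_char_poly G) j)
    = \<i> ^ card (pverts G) * of_real (coeff (abs_char_poly G) j)"
proof -
  interpret pair_graph G by fact
  obtain c :: "'a \<Rightarrow> bool" where c: "\<And>x y. (x, y) \<in> parcs G \<Longrightarrow> c x \<noteq> c y"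
    using assms(2) bipartite_iff_coloring[OF pair_wf_digraph_axioms] by blast
  obtain vs where vs: "distinct vs" "set vs = pverts G"
    using finite_distinct_list[OF pair_finite_verts] by blast
  let ?n = "length vs"
  have n: "card (pverts G) = ?n"
    using vs distinct_card by fastforce
  let ?A = "adjacency_mat G vs"
  \<comment> \<open>Solving \<open>A D = \<i> D S\<close> for \<open>S\<close> keeps the rows of one
    colour and negates those of the other. Every edge joins two colours, so \<open>S\<close> is
    skew-symmetric.\<close>
  define S where "S = mat ?n ?n (\<lambda>(a, b). if c (vs ! a) then ?A $$ (a, b) else - ?A $$ (a, b))"
  have S: "S \<in> carrier_mat ?n ?n" and A: "?A \<in> carrier_mat ?n ?n"
    by (simp_all add: S_def adjacency_mat_def)
  have "transpose_mat S = - S"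
    by (intro eq_matI) (auto simp: S_def adjacency_mat_def dest: c arcs_symmetric)
  then have nonneg: "coeff (char_poly S) j \<ge> 0"
    by (rule coeff_char_poly_skew_symmetric_nonneg[OF S])
  have twist: "\<i> ^ j * of_real (coeff (char_poly ?A) j) = \<i> ^ ?n * of_real (coeff (char_poly S) j)"
    by (rule coeff_char_poly_twist[OF A S, of "\<lambda>a. if c (vs ! a) then 1 else \<i>"])
      (auto simp: S_def adjacency_mat_def dest: c)
  \<comment> \<open>Norms erase the powers of \<open>\<i>\<close>, and nonnegativity removes the
    bars around the coefficient of \<open>S\<close>.\<close>
  from arg_cong[OF twist, of norm] have "\<bar>coeff (char_poly ?A) j\<bar> = coeff (char_poly S) j"
    using nonneg by (simp add: norm_mult norm_power)
  then show ?thesis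
    using twist by (simp add: n coeff_abs_char_poly pair_finite_verts graph_char_poly_eq[OF vs])
qed

section \<open>Cut edges and the subdivided graph\<close>

text \<open>\<open>U\<close> is the set reachable from \<open>u\<close> once the edge is deleted. If
  it contained \<open>v\<close>, the deletion would change no reachability and hence not the number
  of components.\<close>

lemma cut_edge_separation:
  fixes G :: "'a pair_pre_digraph"
  assumes G: "pair_graph G" and cut: "cut_edge G (u, v)"
  obtains U where "u \<in> U" "v \<notin> U"
    "\<And>x y. (x, y) \<in> parcs (delete_edge G (u, v)) \<Longrightarrow> x \<in> U \<longleftrightarrow> y \<in> U"
proof -
  interpret pair_graph G by fact
  let ?H = "delete_edge G (u, v)"
  have uv: "(u, v) \<in> parcs G" and less: "num_components G < num_components ?H"
    using cut by (auto simp: cut_edge_def)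
  interpret H: pair_wf_digraph ?H
    by unfold_locales (auto simp: delete_edge_def dest: in_arcsD1 in_arcsD2)
  have symH: "(y, x) \<in> parcs ?H" if "(x, y) \<in> parcs ?H" for x y
    using that arcs_symmetric by (auto simp: delete_edge_def)
  have verts: "pverts ?H = pverts G"
    by (simp add: delete_edge_def)
  let ?R = "(parcs ?H)\<^sup>*"
  have "sym ?R"
    using symH by (intro sym_rtrancl symI)
  have "(u, v) \<notin> ?R"
  proof
    assume *: "(u, v) \<in> ?R"
    then have "(v, u) \<in> ?R"
      using \<open>sym ?R\<close> by (auto dest: symD)
    have "parcs G \<subseteq> ?R"
    proof
      fix a assume "a \<in> parcs G"
      then show "a \<in> ?R"
        using * \<open>(v, u) \<in> ?R\<close> by (cases "a \<in> {(u, v), (v, u)}") (auto simp: delete_edge_def)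
    qed
    then have R: "(parcs G)\<^sup>* = ?R"
      by (intro rtrancl_subset) (auto simp: delete_edge_def)
    have "reachable (with_proj G) = reachable (with_proj ?H)"
      by (intro ext) (simp add: reachable_conv H.reachable_conv R verts)
    \<comment> \<open>Components are counted by their vertex sets, which depend on reachability
      alone; as subgraphs they would differ by the deleted edge.\<close>
    then have "pre_digraph.sccs_verts (with_proj G) = pre_digraph.sccs_verts (with_proj ?H)"
      by (simp add: pre_digraph.sccs_verts_def)
    then have "num_components G = num_components ?H"
      by (simp add: num_components_def flip: card_sccs_verts H.card_sccs_verts)
    then show False using less by simp
  qed
  moreover have "(u, x) \<in> ?R \<longleftrightarrow> (u, y) \<in> ?R" if "(x, y) \<in> parcs ?H" for x y
    using that symH by (meson rtrancl.rtrancl_into_rtrancl)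
  ultimately show ?thesis
    using that[of "{x. (u, x) \<in> ?R}"] by auto
qed

lemma k_subdivision_arcs:
  fixes G :: "'a pair_pre_digraph"
  shows "(Inl x, Inl y) \<in> parcs (k_subdivision G (u, v) k) \<longleftrightarrow>
      (x, y) \<in> parcs (delete_edge G (u, v)) \<or> k = 0 \<and> (x = u \<and> y = v \<or> x = v \<and> y = u)"
    and "(Inl x, Inr j) \<in> parcs (k_subdivision G (u, v) k) \<longleftrightarrow>
      x = u \<and> j = 0 \<and> 0 < k \<or> x = v \<and> k = Suc j"
    and "(Inr i, Inl y) \<in> parcs (k_subdivision G (u, v) k) \<longleftrightarrow>
      y = u \<and> i = 0 \<and> 0 < k \<or> y = v \<and> k = Suc i"
    and "(Inr i, Inr j) \<in> parcs (k_subdivision G (u, v) k) \<longleftrightarrow>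
      i < k \<and> j < k \<and> (j = Suc i \<or> i = Suc j)"
proof -
  \<comment> \<open>\<open>g\<close> numbers the path: \<open>u\<close> is at position 0,
    \<open>v\<close> at \<open>Suc k\<close>, hence \<open>Inr i\<close> at
    \<open>Suc i\<close>.\<close>
  define g :: "nat \<Rightarrow> 'a + nat" where
    "g i = (if i = 0 then Inl u else if i = Suc k then Inl v else Inr (i - 1))" for i
  let ?p = "Inl u # map Inr [0..<k] @ [Inl v] :: ('a + nat) list"
  have p: "?p = map g [0..<Suc (Suc k)]"
    by (intro nth_equalityI) (auto simp: g_def nth_Cons nth_append split: nat.split)
  have "zip ?p (tl ?p) = map (\<lambda>i. (g i, g (Suc i))) [0..<Suc k]"
    unfolding p by (intro nth_equalityI) (auto simp: nth_tl simp del: upt_Suc)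
  then have "set (zip ?p (tl ?p)) = {(g i, g (Suc i)) |i. i \<le> k}"
    by (auto simp del: upt_Suc)
  then have arcs: "parcs (k_subdivision G (u, v) k) = map_prod Inl Inl ` parcs (delete_edge G (u, v))
      \<union> {(g i, g (Suc i)) |i. i \<le> k} \<union> {(g (Suc i), g i) |i. i \<le> k}"
    by (auto simp: k_subdivision_def path_arcs_def)
  show "(Inl x, Inl y) \<in> parcs (k_subdivision G (u, v) k) \<longleftrightarrow>
      (x, y) \<in> parcs (delete_edge G (u, v)) \<or> k = 0 \<and> (x = u \<and> y = v \<or> x = v \<and> y = u)"
    unfolding arcs by (auto simp: g_def split: if_splits)
  show "(Inl x, Inr j) \<in> parcs (k_subdivision G (u, v) k) \<longleftrightarrow>
      x = u \<and> j = 0 \<and> 0 < k \<or> x = v \<and> k = Suc j"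
    unfolding arcs by (auto simp: g_def split: if_splits)
  show "(Inr i, Inl y) \<in> parcs (k_subdivision G (u, v) k) \<longleftrightarrow>
      y = u \<and> i = 0 \<and> 0 < k \<or> y = v \<and> k = Suc i"
    unfolding arcs by (auto simp: g_def split: if_splits)
  show "(Inr i, Inr j) \<in> parcs (k_subdivision G (u, v) k) \<longleftrightarrow>
      i < k \<and> j < k \<and> (j = Suc i \<or> i = Suc j)"
    unfolding arcs by (auto simp: g_def split: if_splits)
qed

lemma bipartite_k_subdivision:
  fixes G :: "'a pair_pre_digraph"
  assumes G: "pair_graph G" and "bipartite G" and cut: "cut_edge G (u, v)"
  shows "bipartite (k_subdivision G (u, v) k)"
proof -
  interpret pair_graph G by fact
  have uv: "(u, v) \<in> parcs G"
    using cut by (simp add: cut_edge_def)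
  interpret K: pair_graph "k_subdivision G (u, v) k"
    by (rule pair_graph_k_subdivision[OF G uv])
  obtain U where U: "u \<in> U" "v \<notin> U"
    "\<And>x y. (x, y) \<in> parcs (delete_edge G (u, v)) \<Longrightarrow> x \<in> U \<longleftrightarrow> y \<in> U"
    using cut_edge_separation[OF G cut] by blast
  obtain c :: "'a \<Rightarrow> bool" where c: "\<And>x y. (x, y) \<in> parcs G \<Longrightarrow> c x \<noteq> c y"
    using assms(2) bipartite_iff_coloring[OF pair_wf_digraph_axioms] by blast
  have cH: "c x \<noteq> c y" if "(x, y) \<in> parcs (delete_edge G (u, v))" for x y
    using that c by (auto simp: delete_edge_def)
  \<comment> \<open>Colours alternate along the path from \<open>u\<close> and reach
    \<open>v\<close> after \<open>k + 1\<close> changes, in agreement with \<open>c v\<close>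
    exactly for even \<open>k\<close>. For odd \<open>k\<close> everything outside \<open>U\<close>
    is flipped, which is harmless because no arc left after deleting the edge crosses the boundary
    of \<open>U\<close>.\<close>
  define c' where "c' = (\<lambda>z :: 'a + nat. case z of Inl x \<Rightarrow> c x \<noteq> (x \<notin> U \<and> odd k) | Inr i \<Rightarrow> c u = odd i)"
  have "c' z \<noteq> c' z'" if "(z, z') \<in> parcs (k_subdivision G (u, v) k)" for z z'
    using that U(1,2) c[OF uv]
    by (cases z; cases z') (auto simp: k_subdivision_arcs c'_def dest: cH U(3))
  then show ?thesis
    using bipartite_iff_coloring[OF K.pair_wf_digraph_axioms] by blast
qed

section \<open>The recurrence before absolute values are taken\<close>

lemma adjacency_mat_map_cong:
  assumes "\<And>x y. x \<in> set vs \<Longrightarrow> y \<in> set vs \<Longrightarrow> (f x, f y) \<in> parcs G \<longleftrightarrow> (g x, g y) \<in> parcs H"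
  shows "adjacency_mat G (map f vs) = adjacency_mat H (map g vs)"
  using assms by (intro eq_matI) (auto simp: adjacency_mat_def)

text \<open>Splitting at the first edge of the path gives
  \<open>\<alpha> * \<beta> k - \<alpha>' * \<gamma> k\<close>, where the near side enters only
  through constants. The recurrence then follows from \<open>\<gamma> (Suc k) = \<beta> k\<close>
  and \<open>\<beta> (Suc k) = x * \<beta> k - \<gamma> k\<close>.\<close>

lemma graph_char_poly_k_subdivision:
  fixes G :: "'a pair_pre_digraph"
  assumes G: "pair_graph G" and cut: "cut_edge G (u, v)"
  shows "graph_char_poly (k_subdivision G (u, v) (Suc (Suc k)))
    = [:0, 1:] * graph_char_poly (k_subdivision G (u, v) (Suc k))
      - graph_char_poly (k_subdivision G (u, v) k)"
proof -
  interpret pair_graph G by fact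
  have uv: "(u, v) \<in> parcs G"
    using cut by (simp add: cut_edge_def)
  obtain U where U: "u \<in> U" "v \<notin> U"
    "\<And>x y. (x, y) \<in> parcs (delete_edge G (u, v)) \<Longrightarrow> x \<in> U \<longleftrightarrow> y \<in> U"
    using cut_edge_separation[OF G cut] by blast
  obtain us where us: "distinct us" "set us = pverts G \<inter> U - {u}"
    using finite_distinct_list[of "pverts G \<inter> U - {u}"] pair_finite_verts by auto
  obtain vs where vs: "distinct vs" "set vs = pverts G - U - {v}"
    using finite_distinct_list[of "pverts G - U - {v}"] pair_finite_verts by auto
  have delete: "(x, y) \<in> parcs (delete_edge G (u, v)) \<longleftrightarrow>
      (x, y) \<in> parcs G \<and> (x, y) \<noteq> (u, v) \<and> (x, y) \<noteq> (v, u)" for x y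
    by (auto simp: delete_edge_def)
  define Q where "Q k = char_poly \<circ> adjacency_mat (k_subdivision G (u, v) k)" for k
  \<comment> \<open>\<open>tail k\<close> lists the subdivision vertices followed by the far side of the cut edge; dropping the
    first vertex of \<open>tail (k + 1)\<close> gives a relabelled \<open>tail k\<close>.\<close>
  define tail :: "nat \<Rightarrow> ('a + nat) list" where
    "tail k = map Inr [0..<k] @ map Inl (v # vs)" for k
  have tail_head: "\<exists>ws. tail k = (if k = 0 then Inl v else Inr 0) # ws" for k
    by (cases k) (auto simp: tail_def upt_conv_Cons simp del: upt_Suc)
  have tail_distinct: "distinct (tail k)" for k
    using vs by (auto simp: tail_def distinct_map)
  have Suc_Inr: "map Inr [Suc 0..<Suc k] = map (Inr \<circ> Suc) [0..<k]" for k
    by (simp add: map_Suc_upt flip: map_map)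
  define \<alpha> \<alpha>' where "\<alpha> = Q 0 (map Inl (us @ [u]))" and "\<alpha>' = Q 0 (map Inl us)"
  \<comment> \<open>These lists stay inside \<open>U\<close>, so they meet the path only in
    \<open>u\<close> and \<open>k\<close> drops out.\<close>
  have \<alpha>: "Q k (map Inl (us @ [u])) = \<alpha>" and \<alpha>': "Q k (map Inl us) = \<alpha>'" for k
    unfolding \<alpha>_def \<alpha>'_def Q_def o_def using U us
    by (intro arg_cong[where f = char_poly] adjacency_mat_map_cong; auto simp: k_subdivision_arcs)+
  define \<beta> \<gamma> where "\<beta> k = Q k (tail k)" and "\<gamma> k = Q k (tl (tail k))" for k
  have glue: "graph_char_poly (k_subdivision G (u, v) k) = \<alpha> * \<beta> k - \<alpha>' * \<gamma> k" for k
  proof -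
    let ?K = "k_subdivision G (u, v) k"
    obtain b ws where bws: "tail k = b # ws" and b: "b = (if k = 0 then Inl v else Inr 0)"
      using tail_head by blast
    have dist: "distinct (tail k)" "distinct (map Inl us @ [Inl u] :: ('a + nat) list)"
      using us tail_distinct by (auto simp: distinct_map)
    have "graph_char_poly ?K = char_poly (adjacency_mat ?K (map Inl us @ Inl u # tail k))"
      using us vs dist U uv
      by (intro graph_char_poly_eq) (auto simp: tail_def k_subdivision_def dest: in_arcsD1 in_arcsD2)
    also have "\<dots> = Q k (map Inl us @ [Inl u]) * Q k (b # ws) - Q k (map Inl us) * Q k ws"
      unfolding bws Q_def o_def
    proof (rule char_poly_adjacency_glue)
      fix x y assume x: "x \<in> set (map Inl us @ [Inl u])" and y: "y \<in> set (b # ws)"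
        and arc: "(x, y) \<in> parcs ?K \<or> (y, x) \<in> parcs ?K"
      obtain x' where x': "x = Inl x'" "x' \<in> U"
        using x us U by auto
      have "y \<in> Inr ` {..<k} \<union> Inl ` (- U)"
        using y vs U by (auto simp: tail_def simp flip: bws)
      then show "x = Inl u \<and> y = b"
        using arc x' U(1,2) by (auto simp: k_subdivision_arcs b dest: U(3))
    qed (use dist bws U(1,2) in \<open>auto simp: b k_subdivision_arcs delete\<close>)
    finally show ?thesis
      using \<alpha>[of k] \<alpha>'[of k] by (simp add: \<beta>_def \<gamma>_def bws)
  qed
  define shift :: "'a + nat \<Rightarrow> 'a + nat" where "shift = case_sum Inl (Inr \<circ> Suc)"
  have tail_Suc: "tail (Suc k) = Inr 0 # map shift (tail k)" for k
    by (simp add: tail_def shift_def upt_conv_Cons Suc_Inr del: upt_Suc)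
  \<comment> \<open>The edge from \<open>u\<close> to the head of \<open>tail k\<close> is the only
    one that \<open>shift\<close> fails to preserve, and \<open>tail k\<close> avoids
    \<open>u\<close>.\<close>
  have shift: "Q (Suc k) (map shift xs) = Q k xs" if "set xs \<subseteq> set (tail k)" for k xs
  proof -
    have "adjacency_mat (k_subdivision G (u, v) (Suc k)) (map shift xs)
        = adjacency_mat (k_subdivision G (u, v) k) (map id xs)"
    proof (rule adjacency_mat_map_cong)
      fix x y assume "x \<in> set xs" "y \<in> set xs"
      then have "x \<in> Inr ` {..<k} \<union> Inl ` (- U)" "y \<in> Inr ` {..<k} \<union> Inl ` (- U)"
        using that vs U by (auto simp: tail_def)
      then show "(shift x, shift y) \<in> parcs (k_subdivision G (u, v) (Suc k))
          \<longleftrightarrow> (id x, id y) \<in> parcs (k_subdivision G (u, v) k)"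
        using U(1,2) by (auto simp: shift_def k_subdivision_arcs)
    qed
    then show ?thesis
      by (simp add: Q_def)
  qed
  have \<gamma>_Suc: "\<gamma> (Suc k) = \<beta> k" for k
    by (simp add: \<gamma>_def \<beta>_def tail_Suc shift)
  have \<beta>_Suc: "\<beta> (Suc k) = [:0, 1:] * \<beta> k - \<gamma> k" for k
  proof -
    let ?K = "k_subdivision G (u, v) (Suc k)"
    obtain b ws where bws: "tail k = b # ws" and b: "b = (if k = 0 then Inl v else Inr 0)"
      using tail_head by blast
    have "distinct (b # ws)"
      using tail_distinct[of k] by (simp add: bws)
    then have dist: "distinct (map shift (b # ws))"
      by (subst distinct_map) (auto simp: inj_on_def shift_def split: sum.splits)
    \<comment> \<open>Gluing again, now at the pendant vertex \<open>Inr 0\<close>: the near side is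
      a single vertex with polynomial \<open>x\<close>, and removing it leaves the empty list with
      polynomial \<open>1\<close>.\<close>
    have "\<beta> (Suc k) = char_poly (adjacency_mat ?K ([] @ Inr 0 # shift b # map shift ws))"
      by (simp add: \<beta>_def Q_def tail_Suc bws)
    also have "\<dots> = char_poly (adjacency_mat ?K ([] @ [Inr 0]))
          * char_poly (adjacency_mat ?K (shift b # map shift ws))
        - char_poly (adjacency_mat ?K []) * char_poly (adjacency_mat ?K (map shift ws))"
    proof (rule char_poly_adjacency_glue)
      fix x y assume x: "x \<in> set ([] @ [Inr 0])" and y: "y \<in> set (shift b # map shift ws)"
        and arc: "(x, y) \<in> parcs ?K \<or> (y, x) \<in> parcs ?K"
      have "set (shift b # map shift ws) = shift ` set (tail k)"
        by (simp add: bws)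
      then have "y \<in> Inr ` {1..<Suc k} \<union> Inl ` (- U)"
        using y vs U by (auto simp: tail_def shift_def)
      then show "x = Inr 0 \<and> y = shift b"
        using arc x U(1,2) by (auto simp: k_subdivision_arcs b shift_def)
    qed (use dist in \<open>auto simp: b shift_def k_subdivision_arcs delete\<close>)
    also have "char_poly (adjacency_mat ?K []) = 1"
      by (simp add: adjacency_mat_def char_poly_def)
    also have "char_poly (adjacency_mat ?K ([] @ [Inr 0])) = [:0, 1:]"
      by (simp add: adjacency_mat_def char_poly_def char_poly_matrix_def det_single k_subdivision_arcs)
    finally show ?thesis
      using shift[of "b # ws" k] shift[of ws k] by (auto simp: \<beta>_def \<gamma>_def bws Q_def)
  qed
  show ?thesis
    unfolding glue \<gamma>_Suc \<beta>_Suc[of "Suc k"] by (simp add: \<beta>_Suc[of k] algebra_simps)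
qed

theorem theorem2p2:
  fixes G :: "'a pair_pre_digraph" and e :: "'a \<times> 'a"
  assumes "pair_graph G"
    and "bipartite G"
    and "cut_edge G e"
  shows "\<forall>k::nat. abs_char_poly (k_subdivision G e (k + 2))
    = [:0, 1:] * abs_char_poly (k_subdivision G e (k + 1)) + abs_char_poly (k_subdivision G e k)"
proof (intro allI poly_eqI)
  fix k j
  obtain u v where e: "e = (u, v)" by fastforce
  have uv: "(u, v) \<in> parcs G"
    using assms(3) by (simp add: cut_edge_def e)
  define n where "n = card (pverts G)"
  define a where "a k = graph_char_poly (k_subdivision G e k)" for k
  define b where "b k = abs_char_poly (k_subdivision G e k)" for k
  have ab: "\<i> ^ j * of_real (coeff (a k) j) = \<i> ^ (n + k) * of_real (coeff (b k) j)" for j k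
    unfolding a_def b_def e n_def order_k_subdivision[OF assms(1), of "(u, v)", symmetric]
    using assms uv by (intro coeff_graph_char_poly_bipartite pair_graph_k_subdivision
      bipartite_k_subdivision) (auto simp: e)
  have rec: "a (Suc (Suc k)) = pCons 0 (a (Suc k)) - a k"
    using graph_char_poly_k_subdivision[of G u v k] assms by (simp add: a_def e)
  \<comment> \<open>Coefficient \<open>j\<close> of \<open>rec\<close> is multiplied by
    \<open>\<i> ^ j\<close>. Relative to \<open>\<i> ^ (n + k)\<close>, the term for
    \<open>Suc (Suc k)\<close> gains \<open>\<i> ^ 2 = -1\<close> from the order; the term for
    \<open>Suc k\<close> gains one \<open>\<i>\<close> from the order and one from the index shift.
    The term for \<open>k\<close> gains nothing, so its sign flips relative to the others.\<close>
  have "\<i> ^ (n + k) * of_real (coeff (b (Suc (Suc k))) j)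
    = \<i> ^ (n + k) * of_real (coeff (pCons 0 (b (Suc k)) + b k) j)"
  proof (cases j)
    case 0
    then show ?thesis using ab[of j "Suc (Suc k)"] ab[of j k] by (simp add: rec)
  next
    case (Suc m)
    then show ?thesis
      using ab[of j "Suc (Suc k)"] ab[of j k] ab[of m "Suc k"] by (simp add: rec algebra_simps)
  qed
  then have "coeff (b (Suc (Suc k))) j = coeff (pCons 0 (b (Suc k)) + b k) j"
    by (simp only: mult_left_cancel power_eq_0_iff complex_i_not_zero of_real_eq_iff simp_thms)
  then show "coeff (abs_char_poly (k_subdivision G e (k + 2))) j
    = coeff ([:0, 1:] * abs_char_poly (k_subdivision G e (k + 1)) + abs_char_poly (k_subdivision G e k)) j"
    by (simp add: b_def)
qed

end
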